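(* Let $r$ be a complex number and $n\ge1$ an integer. Then, as polynomials in $x$, $$\sum_{k=0}^{n-1}\prod_{s=k+1}^n s(s+2r)\, D_k^{(r)}(x)^2=n(n+2r)\Big(D_{n-1}^{(r)}(x)\frac{d}{dx}D_n^{(r)}(x)-D_n^{(r)}(x)\frac{d}{dx}D_{n-1}^{(r)}(x)\Big)$$ and $$\sum_{k=0}^{n-1}(-1)^k\prod_{s=k+1}^n\frac{s+2r}{s}\, d_k^{(r)}(x)^2=(-1)^{n-1}\frac{n+2r}{2}\Big(d_{n-1}^{(r)}(x)\frac{d}{dx}d_n^{(r)}(x)-d_n^{(r)}(x)\frac{d}{dx}d_{n-1}^{(r)}(x)\Big).$$
   Context: For a complex number $a$ and integer $k\ge0$, $\binom{a}{k}=a(a-1)\cdots(a-k+1)/k!$. For a parameter $r$ and an integer $n\ge 0$, $d_n^{(r)}(x)=\sum_{k=0}^n\binom{x+r+k}{k}\binom{x-r}{n-k}$. The polynomials $D_n^{(r)}(x)$ are defined by $D_{-1}^{(r)}(x)=0$, $D_0^{(r)}(x)=1$ and $D_{n+1}^{(r)}(x)=xD_n^{(r)}(x)-n(n+2r)D_{n-1}^{(r)}(x)$ for $n\ge0$. *)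

theory Defs
  imports Complex_Main "HOL-Computational_Algebra.Polynomial"
begin

(* The library's gchoose needs a field, so it cannot be used with polynomials as upper argument. *)
definition poly_gbinomial :: "complex poly \<Rightarrow> nat \<Rightarrow> complex poly" where
  "poly_gbinomial p k = smult (1 / fact k) (\<Prod>i<k. p - of_nat i)"

lemma poly_poly_gbinomial: "poly (poly_gbinomial p k) x = poly p x gchoose k"
  by (simp add: poly_gbinomial_def poly_prod gbinomial_prod_rev atLeast0LessThan)

definition d_poly :: "complex \<Rightarrow> nat \<Rightarrow> complex poly" where
  "d_poly r n = (\<Sum>k\<le>n. poly_gbinomial [:r + of_nat k, 1:] k * poly_gbinomial [:- r, 1:] (n - k))"

lemma poly_d_poly:
  "poly (d_poly r n) x = (\<Sum>k\<le>n. (x + r + of_nat k gchoose k) * (x - r gchoose (n - k)))"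
  by (simp add: d_poly_def poly_sum poly_poly_gbinomial algebra_simps)

(* Indices start at 0; the second equation is the recurrence at n = 0, where the convention
   that the polynomial of index -1 vanishes makes the second term drop out. *)
fun D_poly :: "complex \<Rightarrow> nat \<Rightarrow> complex poly" where
  "D_poly r 0 = 1"
| "D_poly r (Suc 0) = [:0, 1:]"
| "D_poly r (Suc (Suc n)) =
     [:0, 1:] * D_poly r (Suc n)
     - smult (of_nat (Suc n) * (of_nat (Suc n) + 2 * r)) (D_poly r n)"

lemma D_poly_recurrence:
  "D_poly r (Suc n) =
     [:0, 1:] * D_poly r n
     - smult (of_nat n * (of_nat n + 2 * r)) (if n = 0 then 0 else D_poly r (n - 1))"
  by (cases n) simp_all

end

theory Submission
  imports Defs "HOL-Computational_Algebra.Formal_Power_Series"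
begin

text \<open>
  Both families satisfy a three-term recurrence
  \<open>c p\<^bsub>n+1\<^esub> = q p\<^bsub>n\<^esub> + b p\<^bsub>n-1\<^esub>\<close> with scalars \<open>b, c\<close> and \<open>q\<close> linear in \<open>x\<close>. Differentiating it,
  the terms in \<open>q\<close> cancel from the Wronskian \<open>W\<^bsub>n\<^esub> = p\<^bsub>n-1\<^esub> p\<^bsub>n\<^esub>' - p\<^bsub>n\<^esub> p\<^bsub>n-1\<^esub>'\<close>, which leaves
  \<open>c W\<^bsub>n+1\<^esub> = q' p\<^bsub>n\<^esub>\<^sup>2 - b W\<^bsub>n\<^esub>\<close>; each identity is the solution of this recurrence. For \<open>d\<close> the
  three-term recurrence is read off the generating function
  \<open>F(z) = (1 - z) powr (- x - r - 1) * (1 + z) powr (x - r)\<close>, which satisfies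
  \<open>(1 - z\<^sup>2) F' = (2 x + 1 + (2 r + 1) z) F\<close>.
\<close>

definition poly_wronskian :: "'a :: idom poly \<Rightarrow> 'a poly \<Rightarrow> 'a poly" where
  "poly_wronskian f g = f * pderiv g - g * pderiv f"

lemma poly_wronskian_recurrence:
  assumes "smult c h = q * g + smult b f"
  shows "smult c (poly_wronskian g h) = pderiv q * g\<^sup>2 - smult b (poly_wronskian f g)"
proof -
  have deriv: "smult c (pderiv h) = q * pderiv g + g * pderiv q + smult b (pderiv f)"
    using arg_cong[OF assms, of pderiv]
    by (simp add: pderiv_add pderiv_mult pderiv_smult)
  have "smult c (poly_wronskian g h) = g * smult c (pderiv h) - smult c h * pderiv g"
    by (simp add: poly_wronskian_def smult_diff_right)
  also have "\<dots> = pderiv q * g\<^sup>2 - smult b (poly_wronskian f g)"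
    unfolding deriv assms
    by (simp add: poly_wronskian_def smult_diff_right algebra_simps power2_eq_square)
  finally show ?thesis .
qed

text \<open>Raising the upper limit of the product multiplies every old summand by the same new
  factor, and the new top summand carries that factor alone. So the left side of each identity obeys
  a first-order recurrence that can be matched with that of the Wronskian.\<close>

lemma sum_smult_prod_Suc:
  fixes a w :: "nat \<Rightarrow> 'a :: comm_ring_1" and P :: "nat \<Rightarrow> 'a poly"
  shows "(\<Sum>k = 0..Suc n. smult (w k * (\<Prod>s = k + 1..Suc (Suc n). a s)) (P k))
       = smult (a (Suc (Suc n)))
           ((\<Sum>k = 0..n. smult (w k * (\<Prod>s = k + 1..Suc n. a s)) (P k))
             + smult (w (Suc n)) (P (Suc n)))"
proof -
  have "(\<Sum>k = 0..n. smult (w k * (\<Prod>s = k + 1..Suc (Suc n). a s)) (P k))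
      = smult (a (Suc (Suc n))) (\<Sum>k = 0..n. smult (w k * (\<Prod>s = k + 1..Suc n. a s)) (P k))"
    using sum_distrib_left[of "[:a (Suc (Suc n)):]"
        "\<lambda>k. smult (w k * (\<Prod>s = k + 1..Suc n. a s)) (P k)" "{0..n}"]
    by (simp add: mult_ac)
  then show ?thesis
    by (simp add: smult_add_right mult_ac)
qed

text \<open>\<open>A\<close> is the series of (1 - z) powr (- c - 1). Absorption gives (k + 1)
  a_{k+1} = (c + k + 1) a_k for its coefficients, and subtracting k a_k leaves (c + 1) a_k.\<close>

lemma fps_rising_binomial_deriv:
  fixes c :: complex
  defines "A \<equiv> Abs_fps (\<lambda>k. c + of_nat k gchoose k)"
  shows "(1 - fps_X) * fps_deriv A = fps_const (c + 1) * A"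
proof (rule fps_ext)
  fix k
  have step: "of_nat (Suc k) * (c + of_nat (Suc k) gchoose Suc k)
      = (c + of_nat (Suc k)) * (c + of_nat k gchoose k)" for k
    using gbinomial_absorption[of k "c + of_nat (Suc k)"] by (simp add: algebra_simps)
  show "fps_nth ((1 - fps_X) * fps_deriv A) k = fps_nth (fps_const (c + 1) * A) k"
  proof (cases k)
    case 0
    then show ?thesis using step[of 0] by (simp add: A_def left_diff_distrib)
  next
    case (Suc j)
    have "fps_nth ((1 - fps_X) * fps_deriv A) k
        = of_nat (Suc k) * (c + of_nat (Suc k) gchoose Suc k) - of_nat k * (c + of_nat k gchoose k)"
      by (simp add: A_def left_diff_distrib Suc)
    also have "\<dots> = (c + 1) * (c + of_nat k gchoose k)"
      unfolding step by (simp add: algebra_simps)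
    finally show ?thesis by (simp add: A_def)
  qed
qed

lemma fps_binomial_deriv':
  fixes c :: complex
  shows "(1 + fps_X) * fps_deriv (fps_binomial c) = fps_const c * fps_binomial c"
proof -
  have "fps_deriv (fps_binomial c) = fps_const c * fps_binomial c * inverse (1 + fps_X)"
    unfolding fps_binomial_deriv by (rule fps_divide_unit) simp
  then show ?thesis
    by (simp add: mult.left_commute[of "1 + fps_X"] inverse_mult_eq_1')
qed

lemma d_poly_recurrence:
  "smult (of_nat (Suc (Suc n))) (d_poly r (Suc (Suc n)))
     = [:1, 2:] * d_poly r (Suc n) + smult (of_nat (Suc n) + 2 * r) (d_poly r n)"
\<comment> \<open>A complex polynomial is determined by its values, so \<open>x\<close> can be fixed
  and the generating function has scalar coefficients.\<close>
proof (rule iffD1[OF poly_eq_poly_eq_iff], rule ext)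
  fix x :: complex
  define A where "A = Abs_fps (\<lambda>k. x + r + of_nat k gchoose k)"
  define B where "B = fps_binomial (x - r)"
  define F where "F = A * B"
  \<comment> \<open>The defining sum of \<open>d_poly\<close> is a Cauchy product.\<close>
  have nth: "fps_nth F m = poly (d_poly r m) x" for m
    by (simp add: F_def A_def B_def poly_d_poly fps_mult_nth atLeast0AtMost)
  have A: "(1 - fps_X) * fps_deriv A = fps_const (x + r + 1) * A"
    unfolding A_def by (rule fps_rising_binomial_deriv)
  have B: "(1 + fps_X) * fps_deriv B = fps_const (x - r) * B"
    unfolding B_def by (rule fps_binomial_deriv')
  have "fps_deriv F - fps_X * (fps_X * fps_deriv F)
      = (1 + fps_X) * B * ((1 - fps_X) * fps_deriv A)
        + (1 - fps_X) * A * ((1 + fps_X) * fps_deriv B)"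
    unfolding F_def fps_deriv_mult by (simp add: algebra_simps)
  also have "\<dots> = fps_const (x + r + 1) * (F + fps_X * F) + fps_const (x - r) * (F - fps_X * F)"
    unfolding A B F_def by (simp add: algebra_simps del: fps_const_add fps_const_sub)
  finally have "fps_nth (fps_deriv F - fps_X * (fps_X * fps_deriv F)) (Suc n)
      = fps_nth (fps_const (x + r + 1) * (F + fps_X * F) + fps_const (x - r) * (F - fps_X * F)) (Suc n)"
    by simp
  then have "of_nat (Suc (Suc n)) * fps_nth F (Suc (Suc n)) - of_nat n * fps_nth F n
      = (x + r + 1) * (fps_nth F (Suc n) + fps_nth F n) + (x - r) * (fps_nth F (Suc n) - fps_nth F n)"
    \<comment> \<open>For n = 0 the twice shifted derivative has no coefficient at index 1, in
      agreement with the factor \<open>of_nat n\<close>.\<close>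
    by (cases n) simp_all
  then show "poly (smult (of_nat (Suc (Suc n))) (d_poly r (Suc (Suc n)))) x
      = poly ([:1, 2:] * d_poly r (Suc n) + smult (of_nat (Suc n) + 2 * r) (d_poly r n)) x"
    unfolding nth by (simp add: algebra_simps)
qed

lemma d_poly_0: "d_poly r 0 = 1"
  by (simp add: d_poly_def poly_gbinomial_def)

lemma d_poly_1: "d_poly r (Suc 0) = [:1, 2:]"
  by (simp add: d_poly_def poly_gbinomial_def one_pCons)

lemma sum_D_poly_squares:
  "(\<Sum>k = 0..n. smult (\<Prod>s = k + 1..Suc n. of_nat s * (of_nat s + 2 * r)) ((D_poly r k)\<^sup>2))
     = smult (of_nat (Suc n) * (of_nat (Suc n) + 2 * r)) (poly_wronskian (D_poly r n) (D_poly r (Suc n)))"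
proof (induction n)
  case 0
  show ?case by (simp add: poly_wronskian_def pderiv_pCons)
next
  case (Suc n)
  have "poly_wronskian (D_poly r (Suc n)) (D_poly r (Suc (Suc n)))
      = (D_poly r (Suc n))\<^sup>2 + smult (of_nat (Suc n) * (of_nat (Suc n) + 2 * r))
          (poly_wronskian (D_poly r n) (D_poly r (Suc n)))"
    \<comment> \<open>Here q = x, so q' = 1; the negative b turns the difference into a sum.\<close>
    using poly_wronskian_recurrence[of 1 "D_poly r (Suc (Suc n))" "[:0, 1:]" "D_poly r (Suc n)"
        "- (of_nat (Suc n) * (of_nat (Suc n) + 2 * r))" "D_poly r n"]
    by (simp add: pderiv_pCons)
  then show ?case
    using sum_smult_prod_Suc[of "\<lambda>_. 1" "\<lambda>s. of_nat s * (of_nat s + 2 * r)" n "\<lambda>k. (D_poly r k)\<^sup>2"]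
      Suc.IH by (simp only: mult_1_left smult_1_left add.commute)
qed

lemma sum_d_poly_squares:
  "(\<Sum>k = 0..n. smult ((-1) ^ k * (\<Prod>s = k + 1..Suc n. (of_nat s + 2 * r) / of_nat s)) ((d_poly r k)\<^sup>2))
     = smult ((-1) ^ n * ((of_nat (Suc n) + 2 * r) / 2)) (poly_wronskian (d_poly r n) (d_poly r (Suc n)))"
proof (induction n)
  case 0
  show ?case by (simp add: poly_wronskian_def pderiv_pCons d_poly_0 d_poly_1 one_pCons power2_eq_square add_divide_distrib)
next
  case (Suc n)
  define W where "W = poly_wronskian (d_poly r n) (d_poly r (Suc n))"
  define V where "V = poly_wronskian (d_poly r (Suc n)) (d_poly r (Suc (Suc n)))"
  define Q where "Q = (d_poly r (Suc n))\<^sup>2"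
  define m :: complex where "m = of_nat (Suc (Suc n))"
  have m: "m \<noteq> 0" unfolding m_def by (rule of_nat_neq_0)
  \<comment> \<open>The coefficient 2 is the derivative of q = 1 + 2 x.\<close>
  have rec: "smult m V = smult 2 Q - smult (of_nat (Suc n) + 2 * r) W"
    using poly_wronskian_recurrence[OF d_poly_recurrence, of n r]
    by (simp add: V_def W_def Q_def m_def pderiv_pCons)
  have "smult ((-1) ^ n * ((of_nat (Suc n) + 2 * r) / 2)) W + smult ((-1) ^ Suc n) Q
      = smult ((-1) ^ Suc n / 2) (smult 2 Q - smult (of_nat (Suc n) + 2 * r) W)"
    by (simp add: smult_diff_right)
  also have "\<dots> = smult ((-1) ^ Suc n / 2) (smult m V)"
    unfolding rec ..
  \<comment> \<open>The denominator of the new factor, at s = n + 2, cancels the leading coefficient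
    \<open>m\<close> of the recurrence.\<close>
  finally have "smult ((m + 2 * r) / m)
      (smult ((-1) ^ n * ((of_nat (Suc n) + 2 * r) / 2)) W + smult ((-1) ^ Suc n) Q)
      = smult ((-1) ^ Suc n * ((m + 2 * r) / 2)) V"
    using m by (simp add: mult_ac)
  then show ?case
    unfolding sum_smult_prod_Suc Suc.IH V_def W_def Q_def m_def .
qed

theorem theorem3p2:
  fixes r :: complex and n :: nat
  assumes "n \<ge> 1"
  shows "(\<Sum>k = 0..n - 1.
            smult (\<Prod>s = k + 1..n. of_nat s * (of_nat s + 2 * r)) ((D_poly r k)\<^sup>2))
         = smult (of_nat n * (of_nat n + 2 * r))
             (D_poly r (n - 1) * pderiv (D_poly r n) - D_poly r n * pderiv (D_poly r (n - 1)))
       \<and> (\<Sum>k = 0..n - 1.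
            smult ((-1) ^ k * (\<Prod>s = k + 1..n. (of_nat s + 2 * r) / of_nat s)) ((d_poly r k)\<^sup>2))
         = smult ((-1) ^ (n - 1) * ((of_nat n + 2 * r) / 2))
             (d_poly r (n - 1) * pderiv (d_poly r n) - d_poly r n * pderiv (d_poly r (n - 1)))"
proof -
  obtain m where "n = Suc m" using assms by (cases n) auto
  then show ?thesis
    using sum_D_poly_squares[of r m] sum_d_poly_squares[of r m]
    by (simp only: poly_wronskian_def diff_Suc_1 simp_thms)
qed

end
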